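(* Let $n,q,k$ be positive integers. Then $$\#\{\sigma\in S_{n+q-1}\mid Del_q(\sigma)-1=Des_q(\sigma)\ \text{ and }\ del_q(\sigma)=k-1\}=(q-1)!\,q^k\,S(n,k),$$ where $S(n,k)$ is the Stirling number of the second kind.
   Context: Let $m=n+q-1$ and $\sigma\in S_m$. Permutations are multiplied as functions: $(\sigma\tau)(i)=\sigma(\tau(i))$; $s_i=(i,i+1)$. Canonical presentation: for $1\le j\le m-1$ let $R_j=\{1,\ s_j,\ s_js_{j-1},\ \ldots,\ s_js_{j-1}\cdots s_1\}$. Every $w\in S_m$ can be written uniquely as $w=w_1\cdots w_{m-1}$ with $w_j\in R_j$; this product, regarded as a word in the $s_i$ (each $w_j$ being spelled as displayed), is the canonical presentation of $w$. $del_q(\sigma)$ is the number of times $s_q$ appears in the canonical presentation of $\sigma$. $Del_q(\sigma)=\{ i \mid q+1\le i\le m,\ \#\{j<i\mid \sigma(j)<\sigma(i)\}\le q-1\}$, and $Del_q(\sigma)-1=\{i-1\mid i\in Del_q(\sigma)\}$. The $q$-descent set $Des_q(\sigma)$ is the set of $i$ with $q\le i\le m-1$ such that $\sigma(i)>\sigma(i+1)$ or $i+1\in Del_q(\sigma)$ (or both). *)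

theory Defs
  imports Main "HOL-Combinatorics.Permutations" "HOL-Combinatorics.Stirling"
begin

text \<open>
  The symmetric group \<open>S\<^sub>m\<close> is the set of all \<open>\<sigma> :: nat \<Rightarrow> nat\<close> with \<open>\<sigma> permutes {1..m}\<close>, and its
  product is function composition. A word \<open>[i\<^sub>1, \<dots>, i\<^sub>r]\<close> stands for \<open>s\<^bsub>i\<^sub>1\<^esub> \<cdots> s\<^bsub>i\<^sub>r\<^esub>\<close>,
  where \<open>s\<^sub>i = (i, i + 1)\<close>.
\<close>

definition adj_transp :: "nat \<Rightarrow> nat \<Rightarrow> nat" where
  "adj_transp i = transpose i (Suc i)"

definition word_perm :: "nat list \<Rightarrow> nat \<Rightarrow> nat" where
  "word_perm u = foldr (\<lambda>i \<tau>. adj_transp i \<circ> \<tau>) u id"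

text \<open>
  The words \<open>s\<^sub>j s\<^bsub>j-1\<^esub> \<cdots> s\<^sub>i\<close> with \<open>1 \<le> i \<le> j\<close> spelling the elements of \<open>R\<^sub>j\<close>;
  the value \<open>i = j + 1\<close> gives the empty word, which spells the identity.
\<close>

definition R_words :: "nat \<Rightarrow> nat list set" where
  "R_words j = {rev [i..<Suc j] | i. 1 \<le> i \<and> i \<le> Suc j}"

text \<open>The list \<open>ws = [w\<^sub>1, \<dots>, w\<^bsub>m-1\<^esub>]\<close> is 0-indexed, so \<open>w\<^sub>j\<close> is \<open>ws ! (j - 1)\<close>.\<close>

definition is_canonical_factorization :: "nat \<Rightarrow> (nat \<Rightarrow> nat) \<Rightarrow> nat list list \<Rightarrow> bool" where
  "is_canonical_factorization m w ws \<longleftrightarrow>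
     length ws = m - 1 \<and> (\<forall>j\<in>{1..m - 1}. ws ! (j - 1) \<in> R_words j) \<and> word_perm (concat ws) = w"

definition canonical_presentation :: "nat \<Rightarrow> (nat \<Rightarrow> nat) \<Rightarrow> nat list" where
  "canonical_presentation m w = concat (THE ws. is_canonical_factorization m w ws)"

definition del :: "nat \<Rightarrow> nat \<Rightarrow> (nat \<Rightarrow> nat) \<Rightarrow> nat" where
  "del m q \<sigma> = count_list (canonical_presentation m \<sigma>) q"

definition Del :: "nat \<Rightarrow> nat \<Rightarrow> (nat \<Rightarrow> nat) \<Rightarrow> nat set" where
  "Del m q \<sigma> = {i. q + 1 \<le> i \<and> i \<le> m \<and> card {j. 1 \<le> j \<and> j < i \<and> \<sigma> j < \<sigma> i} \<le> q - 1}"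

definition Des :: "nat \<Rightarrow> nat \<Rightarrow> (nat \<Rightarrow> nat) \<Rightarrow> nat set" where
  "Des m q \<sigma> = {i. q \<le> i \<and> i \<le> m - 1 \<and> (\<sigma> i > \<sigma> (i + 1) \<or> i + 1 \<in> Del m q \<sigma>)}"


text \<open>Existence and uniqueness of the canonical presentation, so that the description above denotes.\<close>

lemma word_perm_simps [simp]:
  "word_perm [] = id" "word_perm (i # u) = adj_transp i \<circ> word_perm u"
  by (simp_all add: word_perm_def)

lemma word_perm_append [simp]: "word_perm (u @ v) = word_perm u \<circ> word_perm v"
  by (induction u) (simp_all add: comp_assoc)

lemma word_perm_permutes:
  assumes "\<And>i. i \<in> set u \<Longrightarrow> 1 \<le> i \<and> i < m"
  shows "word_perm u permutes {1..m}"
  using assms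
proof (induction u)
  case Nil
  then show ?case by (simp only: word_perm_simps permutes_id)
next
  case (Cons i u)
  have "adj_transp i permutes {1..m}"
    unfolding adj_transp_def using Cons.prems[of i] by (intro permutes_swap_id) auto
  moreover have "word_perm u permutes {1..m}" using Cons by auto
  ultimately show ?case by (metis permutes_compose word_perm_simps(2))
qed

lemma word_perm_rev_upt: "i \<le> Suc j \<Longrightarrow> word_perm (rev [i..<Suc j]) i = Suc j"
proof (induction j)
  case 0
  then show ?case by (cases i) (auto simp: adj_transp_def)
next
  case (Suc j)
  then show ?case by (cases "i = Suc (Suc j)") (auto simp: adj_transp_def)
qed

lemma is_canonical_factorization_permutes:
  assumes "is_canonical_factorization m w ws"
  shows "w permutes {1..m}"
proof -
  have "1 \<le> i \<and> i < m" if i: "i \<in> set (concat ws)" for i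
  proof -
    obtain k where k: "k < length ws" "i \<in> set (ws ! k)"
      using i by (metis (no_types, lifting) UN_E in_set_conv_nth set_concat)
    then have "ws ! (Suc k - 1) \<in> R_words (Suc k)"
      using assms unfolding is_canonical_factorization_def by fastforce
    with k assms show ?thesis
      by (auto simp: R_words_def is_canonical_factorization_def)
  qed
  then have "word_perm (concat ws) permutes {1..m}" by (rule word_perm_permutes)
  with assms show ?thesis by (simp add: is_canonical_factorization_def)
qed

lemma is_canonical_factorization_snoc:
  assumes "1 \<le> m"
  shows "is_canonical_factorization (Suc m) w (us @ [b]) \<longleftrightarrow>
    b \<in> R_words m \<and> (\<exists>v. is_canonical_factorization m v us \<and> w = v \<circ> word_perm b)"
proof -
  have "{1..m} = insert m {1..m - 1}" using assms by auto
  moreover have "(us @ [b]) ! (j - 1) = us ! (j - 1)" if "j \<in> {1..m - 1}" "length us = m - 1" for j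
    using that by (auto simp: nth_append)
  ultimately show ?thesis
    using assms unfolding is_canonical_factorization_def
    by (auto simp: nth_append)
qed

theorem canonical_factorization_ex1:
  assumes "w permutes {1..m}"
  shows "\<exists>!ws. is_canonical_factorization m w ws"
  using assms
proof (induction m arbitrary: w)
  case 0
  then show ?case by (auto simp: is_canonical_factorization_def fun_eq_iff)
next
  case (Suc m)
  show ?case
  proof (cases "m = 0")
    case True
    with Suc.prems have "w permutes {1}" by simp
    then have "w = id" by simp
    with True show ?thesis by (auto simp: is_canonical_factorization_def id_def)
  next
    case False
    then have m: "1 \<le> m" by simp
    define i where "i = inv w (Suc m)"
    have wi: "w i = Suc m" unfolding i_def using Suc.prems by (simp add: permutes_inverses)
    have "inv w permutes {1..Suc m}" using Suc.prems by (rule permutes_inv)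
    then have i: "1 \<le> i" "i \<le> Suc m"
      using permutes_in_image[of "inv w" "{1..Suc m}" "Suc m"] by (auto simp: i_def)
    define b where "b = rev [i..<Suc m]"
    have bR: "b \<in> R_words m" using i by (auto simp: R_words_def b_def)
    have cp: "word_perm b permutes {1..Suc m}"
      by (rule word_perm_permutes) (use i in \<open>auto simp: b_def\<close>)
    have ci: "word_perm b i = Suc m" unfolding b_def using i by (intro word_perm_rev_upt)
    define v where "v = w \<circ> inv (word_perm b)"
    have wv: "w = v \<circ> word_perm b"
      unfolding v_def by (simp add: comp_assoc permutes_inv_o(2)[OF cp])
    have "v permutes {1..Suc m}"
      unfolding v_def by (rule permutes_compose[OF permutes_inv[OF cp] Suc.prems])
    moreover have "v (Suc m) = Suc m" using wi ci by (simp add: wv)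
    ultimately have "v permutes {1..m}"
      by (elim permutes_superset) (auto simp: le_Suc_eq)
    then obtain us where us: "is_canonical_factorization m v us"
      and uniq: "\<And>us'. is_canonical_factorization m v us' \<Longrightarrow> us' = us"
      using Suc.IH by blast
    show ?thesis
    proof
      show "is_canonical_factorization (Suc m) w (us @ [b])"
        using us bR wv by (auto simp: is_canonical_factorization_snoc[OF m])
    next
      fix ws assume ws: "is_canonical_factorization (Suc m) w ws"
      then have "ws \<noteq> []" using m by (auto simp: is_canonical_factorization_def)
      then obtain us' b' where e: "ws = us' @ [b']" by (metis rev_exhaust)
      from ws obtain v' where v': "is_canonical_factorization m v' us'" "w = v' \<circ> word_perm b'"
        and b': "b' \<in> R_words m"
        unfolding e is_canonical_factorization_snoc[OF m] by blast
      from b' obtain i' where i': "b' = rev [i'..<Suc m]" "1 \<le> i'" "i' \<le> Suc m"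
        by (auto simp: R_words_def)
      have "v' (Suc m) = Suc m"
        using is_canonical_factorization_permutes[OF v'(1)] by (simp add: permutes_def)
      then have "w i' = Suc m"
        using word_perm_rev_upt[OF i'(3)] i'(1) v'(2) by simp
      then have "i' = i" using wi permutes_inj[OF Suc.prems] by (metis injD)
      then have bb: "b' = b" using i'(1) by (simp add: b_def)
      have "v = v' \<circ> (word_perm b \<circ> inv (word_perm b))"
        unfolding v_def v'(2) bb by (simp add: comp_assoc)
      then have "v' = v" by (simp add: permutes_inv_o(1)[OF cp])
      then show "ws = us @ [b]" using uniq v'(1) e bb by simp
    qed
  qed
qed

end

theory Submission
  imports Defs
begin

text \<open>
  Write \<open>\<sigma> \<in> S\<^bsub>m + 1\<^esub>\<close> in one-line notation and delete its largest entry \<open>m + 1\<close>, say at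
  position \<open>p\<close>; what remains is some \<open>v \<in> S\<^sub>m\<close>, and \<open>(v, p)\<close> determines \<open>\<sigma>\<close>. In terms of
  canonical presentations this strips off the last factor: \<open>\<sigma> = v w\<^sub>m\<close> with
  \<open>w\<^sub>m = s\<^sub>m \<cdots> s\<^sub>p\<close>. \<open>del\<close>, \<open>Del\<close> and the descents change in a simple way under the insertion
  of \<open>m + 1\<close> into \<open>v\<close>, for \<open>q \<le> m\<close>.

  If \<open>p \<le> q\<close>, then \<open>w\<^sub>m\<close> contains \<open>s\<^sub>q\<close> once. The set \<open>Del\<close> also gains one element, because
  the entry at position \<open>q\<close> is pushed to position \<open>q + 1\<close> with at most \<open>q - 1\<close> smaller entries to
  its left. If \<open>p > q\<close>, then \<open>w\<^sub>m\<close> does not contain \<open>s\<^sub>q\<close>, and \<open>Del\<close> only has some of its elements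
  shifted. By induction \<open>del\<close> is the cardinality of \<open>Del\<close> (\<open>del_eq_card_Del\<close>).

  Since \<open>Del - 1 \<subseteq> Des\<close> by the definition of \<open>Des\<close>, the condition \<open>Del - 1 = Des\<close> says that each
  descent \<open>i \<ge> q\<close> has \<open>i + 1 \<in> Del\<close> (\<open>Del_eq_Des_iff\<close>). Inserting the maximum at a position
  \<open>p \<le> q\<close> never affects this. At a position \<open>p > q\<close> it creates a descent in front of the entry that
  was at position \<open>p\<close>, so the condition survives exactly if \<open>p = m + 1\<close> or \<open>p \<in> Del\<close>.

  Hence, if \<open>T(m, k)\<close> counts the \<open>\<sigma> \<in> S\<^sub>m\<close> with this property and \<open>k\<close> elements in \<open>Del\<close>, then
  \<open>T(m + 1, k) = q T(m, k - 1) + (k + 1) T(m, k)\<close> for \<open>m \<ge> q\<close> (\<open>card_del_perms_Suc\<close>). Up to the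
  weight \<open>(q - 1)! q\<^bsup>k + 1\<^esup>\<close> this is the recurrence of the Stirling numbers \<open>S(m - q + 1, k + 1)\<close>,
  and at \<open>m = q\<close> all \<open>q!\<close> permutations have the property, with empty \<open>Del\<close>.
\<close>

section \<open>Inserting the maximum\<close>

text \<open>
  Right multiplication by the factor \<open>s\<^sub>m \<cdots> s\<^sub>p\<close> permutes positions, so it inserts the value
  \<open>m + 1\<close> at position \<open>p\<close> of the one-line notation. Spelling it as a word makes it literally the
  last factor of a canonical factorization.
\<close>

definition insert_max :: "nat \<Rightarrow> nat \<Rightarrow> (nat \<Rightarrow> nat) \<Rightarrow> nat \<Rightarrow> nat" where
  "insert_max m p v = v \<circ> word_perm (rev [p..<Suc m])"

lemma word_perm_rev_upt_apply:
  assumes "1 \<le> p" "p \<le> Suc m"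
  shows "word_perm (rev [p..<Suc m]) x =
    (if x < p then x else if x = p then Suc m else if x \<le> Suc m then x - 1 else x)"
  using assms
proof (induction m)
  case 0
  then have "p = 1" by simp
  then show ?case by (auto simp: adj_transp_def transpose_def)
next
  case (Suc m)
  show ?case
  proof (cases "p = Suc (Suc m)")
    case True
    then show ?thesis by (auto simp: adj_transp_def transpose_def)
  next
    case False
    with Suc.prems have p: "p \<le> Suc m" by simp
    then have "rev [p..<Suc (Suc m)] = Suc m # rev [p..<Suc m]" by simp
    then have "word_perm (rev [p..<Suc (Suc m)]) x = adj_transp (Suc m) (word_perm (rev [p..<Suc m]) x)"
      by simp
    then show ?thesis
      using Suc.IH[OF Suc.prems(1) p] p by (auto simp: adj_transp_def transpose_def)
  qed
qed

lemma insert_max_apply: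
  assumes "v permutes {1..m}" "1 \<le> p" "p \<le> Suc m"
  shows "i < p \<Longrightarrow> insert_max m p v i = v i"
    and "insert_max m p v p = Suc m"
    and "p \<le> i \<Longrightarrow> i \<le> m \<Longrightarrow> insert_max m p v (Suc i) = v i"
  using assms permutes_not_in[OF assms(1), of "Suc m"]
  by (simp_all add: insert_max_def word_perm_rev_upt_apply del: upt_Suc)

lemma permutes_le:
  assumes "v permutes {1..m}" "i \<le> m"
  shows "v i \<le> (m::nat)"
proof (cases "i = 0")
  case True
  then show ?thesis using permutes_not_in[OF assms(1), of i] by simp
next
  case False
  then show ?thesis using permutes_in_image[OF assms(1), of i] assms(2) by auto
qed

lemma insert_max_permutes:
  assumes "v permutes {1..m}" "1 \<le> p" "p \<le> Suc m"
  shows "insert_max m p v permutes {1..Suc m}"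
proof -
  have "word_perm (rev [p..<Suc m]) permutes {1..Suc m}"
    by (rule word_perm_permutes) (use assms in auto)
  moreover have "v permutes {1..Suc m}" by (rule permutes_subset[OF assms(1)]) auto
  ultimately show ?thesis unfolding insert_max_def by (rule permutes_compose)
qed

text \<open>
  The position of \<open>m + 1\<close> recovers \<open>p\<close> and then cancelling the last factor recovers \<open>v\<close>;
  surjectivity follows from \<open>m! (m + 1) = (m + 1)!\<close>.
\<close>

lemma bij_betw_insert_max:
  "bij_betw (\<lambda>(v, p). insert_max m p v) ({v. v permutes {1..m}} \<times> {1..Suc m})
     {\<sigma>. \<sigma> permutes {1..Suc m}}"
proof -
  let ?f = "\<lambda>(v, p). insert_max m p v"
  let ?X = "{v. v permutes {1..m}} \<times> {1..Suc m}"
  have inj: "inj_on ?f ?X"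
  proof (rule inj_onI, clarsimp simp del: One_nat_def)
    fix v p v' p'
    assume v: "v permutes {1..m}" "v' permutes {1..m}"
      and p: "1 \<le> p" "p \<le> Suc m" "1 \<le> p'" "p' \<le> Suc m"
      and eq: "insert_max m p v = insert_max m p' v'"
    have "insert_max m p v p = insert_max m p v p'"
      using insert_max_apply(2)[OF v(1) p(1,2)] insert_max_apply(2)[OF v(2) p(3,4)] eq by simp
    then have "p = p'"
      using permutes_inj[OF insert_max_permutes[OF v(1) p(1,2)]] by (meson injD)
    moreover have "v = v'"
    proof (rule surj_fun_eq)
      have "word_perm (rev [p..<Suc m]) permutes {1..Suc m}"
        by (rule word_perm_permutes) (use p in auto)
      then show "word_perm (rev [p..<Suc m]) ` UNIV = UNIV" by (rule permutes_surj)
      show "\<forall>x\<in>UNIV. (v \<circ> word_perm (rev [p..<Suc m])) x = (v' \<circ> word_perm (rev [p..<Suc m])) x"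
        using eq \<open>p = p'\<close> by (simp add: insert_max_def del: upt_Suc)
    qed
    ultimately show "v = v' \<and> p = p'" by simp
  qed
  have "?f ` ?X = {\<sigma>. \<sigma> permutes {1..Suc m}}"
  proof (rule card_subset_eq)
    show "?f ` ?X \<subseteq> {\<sigma>. \<sigma> permutes {1..Suc m}}"
      using insert_max_permutes by auto
    show "card (?f ` ?X) = card {\<sigma>. \<sigma> permutes {1..Suc m}}"
      using card_image[OF inj] card_permutations[of "{1..m}" m] card_permutations[of "{1..Suc m}" "Suc m"]
      by (simp add: card_cartesian_product)
  qed (simp add: finite_permutations)
  with inj show ?thesis by (simp add: bij_betw_def)
qed

lemma insert_max_cases:
  assumes "\<sigma> permutes {1..Suc m}"
  obtains v p where "v permutes {1..m}" "1 \<le> p" "p \<le> Suc m" "\<sigma> = insert_max m p v"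
proof -
  have "\<sigma> \<in> (\<lambda>(v, p). insert_max m p v) ` ({v. v permutes {1..m}} \<times> {1..Suc m})"
    using assms bij_betw_imp_surj_on[OF bij_betw_insert_max[of m]] by simp
  then show thesis using that by auto
qed

section \<open>Del under insertion of the maximum\<close>

definition smaller_left :: "(nat \<Rightarrow> nat) \<Rightarrow> nat \<Rightarrow> nat" where
  "smaller_left \<sigma> i = card {j. 1 \<le> j \<and> j < i \<and> \<sigma> j < \<sigma> i}"

lemma smaller_left_less: "0 < i \<Longrightarrow> smaller_left \<sigma> i < i"
proof -
  assume "0 < i"
  have "smaller_left \<sigma> i \<le> card {1..<i}"
    unfolding smaller_left_def by (rule card_mono) auto
  with \<open>0 < i\<close> show ?thesis by simp
qed

text \<open>
  The inserted maximum exceeds all entries to its left and is never counted for another entry.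
\<close>

lemma smaller_left_insert_max:
  assumes "v permutes {1..m}" "1 \<le> p" "p \<le> Suc m"
  shows "i < p \<Longrightarrow> smaller_left (insert_max m p v) i = smaller_left v i"
    and "smaller_left (insert_max m p v) p = p - 1"
    and "p \<le> i \<Longrightarrow> i \<le> m \<Longrightarrow> smaller_left (insert_max m p v) (Suc i) = smaller_left v i"
proof -
  note ins = insert_max_apply[OF assms]
  show "smaller_left (insert_max m p v) i = smaller_left v i" if "i < p"
    unfolding smaller_left_def by (rule arg_cong[of _ _ card]) (use that ins(1) in auto)
  have "{j. 1 \<le> j \<and> j < p \<and> insert_max m p v j < insert_max m p v p} = {1..<p}"
    using ins(1,2) permutes_le[OF assms(1)] assms(3) by (auto simp: less_Suc_eq_le)
  then show "smaller_left (insert_max m p v) p = p - 1"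
    by (simp add: smaller_left_def)
  show "smaller_left (insert_max m p v) (Suc i) = smaller_left v i" if i: "p \<le> i" "i \<le> m"
  proof -
    let ?s = "\<lambda>j. if j < p then j else Suc j"
    let ?A = "{j. 1 \<le> j \<and> j < i \<and> v j < v i}"
    have "{j. 1 \<le> j \<and> j < Suc i \<and> insert_max m p v j < insert_max m p v (Suc i)} = ?s ` ?A"
      (is "?L = _")
    proof (intro equalityI subsetI)
      fix j assume j: "j \<in> ?L"
      then have "j \<noteq> p" using ins(2) ins(3)[OF i] permutes_le[OF assms(1) i(2)] by auto
      then consider "j < p" | j' where "j = Suc j'" "p \<le> j'"
        by (metis linorder_neqE_nat less_imp_Suc_add le_add1)
      then show "j \<in> ?s ` ?A"
      proof cases
        case 1
        then show ?thesis using j ins(1)[OF 1] ins(3)[OF i] i by (intro image_eqI[of _ _ j]) auto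
      next
        case 2
        then show ?thesis using j ins(3)[of j'] ins(3)[OF i] i assms(2)
          by (intro image_eqI[of _ _ j']) auto
      qed
    next
      fix j assume "j \<in> ?s ` ?A"
      then obtain j' where j': "j = ?s j'" "1 \<le> j'" "j' < i" "v j' < v i"
        by (elim imageE) blast
      then show "j \<in> ?L" using ins(1)[of j'] ins(3)[of j'] ins(3)[OF i] i by auto
    qed
    moreover have "inj_on ?s ?A" by (auto simp: inj_on_def)
    ultimately show ?thesis unfolding smaller_left_def by (simp only: card_image)
  qed
qed

lemma Del_iff:
  assumes "0 < q"
  shows "i \<in> Del m q \<sigma> \<longleftrightarrow> q < i \<and> i \<le> m \<and> smaller_left \<sigma> i < q"
  using assms by (auto simp: Del_def smaller_left_def)

lemma finite_Del [simp]: "finite (Del m q \<sigma>)"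
  by (rule finite_subset[of _ "{..m}"]) (auto simp: Del_def)

text \<open>
  The new element is \<open>q + 1\<close>: the entry moved there from position \<open>q\<close> has at most \<open>q - 1\<close>
  smaller entries to its left, among them never the maximum.
\<close>

lemma Del_insert_max_early:
  assumes v: "v permutes {1..m}" and p: "1 \<le> p" "p \<le> q" and m: "q \<le> m"
  shows "Del (Suc m) q (insert_max m p v) = Suc ` insert q (Del m q v)"
proof -
  have q: "0 < q" using p by simp
  have p': "p \<le> Suc m" using p m by simp
  have "i \<in> Del (Suc m) q (insert_max m p v) \<longleftrightarrow> i \<in> Suc ` insert q (Del m q v)" for i
  proof (cases i)
    case (Suc j)
    then show ?thesis
      using smaller_left_insert_max(3)[OF v p(1) p', of j] smaller_left_less[OF q, of v] p m
      by (auto simp: Del_iff[OF q])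
  qed (auto simp: Del_iff[OF q])
  then show ?thesis by blast
qed

text \<open>
  The maximum itself has \<open>p - 1 \<ge> q\<close> smaller entries to its left, so \<open>p\<close> does not enter \<open>Del\<close>.
\<close>

lemma Del_insert_max_late:
  assumes v: "v permutes {1..m}" and p: "q < p" "p \<le> Suc m" and q: "0 < q"
  shows "Del (Suc m) q (insert_max m p v) = (\<lambda>i. if i < p then i else Suc i) ` Del m q v"
    (is "?L = ?s ` _")
proof -
  have p1: "1 \<le> p" using p by simp
  note sl = smaller_left_insert_max[OF v p1 p(2)]
  have "i \<in> ?L \<longleftrightarrow> i \<in> ?s ` Del m q v" for i
  proof -
    consider "i < p" | "i = p" | j where "i = Suc j" "p \<le> j"
      by (metis linorder_neqE_nat less_imp_Suc_add le_add1)
    then show ?thesis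
    proof cases
      case 1
      then show ?thesis using sl(1)[of i] p by (auto simp: Del_iff[OF q] image_iff)
    next
      case 2
      then show ?thesis using sl(2) p by (auto simp: Del_iff[OF q] image_iff)
    next
      case 3
      then show ?thesis using sl(3)[of j] p by (auto simp: Del_iff[OF q] image_iff)
    qed
  qed
  then show ?thesis by blast
qed

lemma card_Del_insert_max:
  assumes v: "v permutes {1..m}" and p: "1 \<le> p" "p \<le> Suc m" and q: "0 < q"
  shows "card (Del (Suc m) q (insert_max m p v)) =
    card (Del m q v) + (if p \<le> q \<and> q \<le> m then 1 else 0)"
proof (cases "q \<le> m")
  case False
  then have "Del (Suc m) q (insert_max m p v) = {}" "Del m q v = {}"
    by (auto simp: Del_def)
  with False show ?thesis by simp
next
  case m: True
  show ?thesis
  proof (cases "p \<le> q")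
    case True
    have "card (Suc ` insert q (Del m q v)) = card (insert q (Del m q v))"
      by (rule card_image) (simp only: inj_Suc inj_on_def, simp)
    moreover have "q \<notin> Del m q v" by (simp add: Del_iff[OF q])
    ultimately show ?thesis
      using True m by (simp only: Del_insert_max_early[OF v p(1) True m]) simp
  next
    case False
    then have "q < p" by simp
    have "inj_on (\<lambda>i. if i < p then i else Suc i) (Del m q v)" by (auto simp: inj_on_def)
    from card_image[OF this] False show ?thesis
      by (simp only: Del_insert_max_late[OF v \<open>q < p\<close> p(2) q]) simp
  qed
qed

section \<open>The letter count of the canonical presentation\<close>

lemma is_canonical_factorization_small:
  "is_canonical_factorization (Suc 0) id []" "is_canonical_factorization 0 id []"
  by (auto simp: is_canonical_factorization_def)

lemma canonical_presentation_eq: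
  assumes "is_canonical_factorization m w ws"
  shows "canonical_presentation m w = concat ws"
  unfolding canonical_presentation_def
  using the1_equality[OF canonical_factorization_ex1[OF is_canonical_factorization_permutes[OF assms]] assms]
  by simp

text \<open>
  The new letters are \<open>m, m - 1, \<dots>, p\<close>, each occurring once.
\<close>

lemma del_insert_max:
  assumes v: "v permutes {1..m}" and p: "1 \<le> p" "p \<le> Suc m" and m: "1 \<le> m"
  shows "del (Suc m) q (insert_max m p v) = del m q v + (if p \<le> q \<and> q \<le> m then 1 else 0)"
proof -
  let ?b = "rev [p..<Suc m]"
  obtain us where us: "is_canonical_factorization m v us"
    using canonical_factorization_ex1[OF v] by blast
  have "?b \<in> R_words m" using p by (auto simp: R_words_def)
  with us have "is_canonical_factorization (Suc m) (insert_max m p v) (us @ [?b])"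
    using m by (auto simp: is_canonical_factorization_snoc insert_max_def)
  then have "del (Suc m) q (insert_max m p v) = count_list (concat us @ ?b) q"
    by (simp add: del_def canonical_presentation_eq)
  also have "\<dots> = del m q v + count_list ?b q"
    using us by (simp add: del_def canonical_presentation_eq del: upt_Suc)
  also have "count_list ?b q = (if p \<le> q \<and> q \<le> m then 1 else 0)"
    by (simp add: count_list_rev count_list_eq_length_filter distinct_length_filter del: upt_Suc)
       (auto simp: Int_def)
  finally show ?thesis .
qed

text \<open>
  Both sides grow by the same amount when the maximum is inserted.
\<close>

theorem del_eq_card_Del:
  assumes "\<sigma> permutes {1..m}" and q: "0 < q"
  shows "del m q \<sigma> = card (Del m q \<sigma>)"
  using assms(1)
proof (induction m arbitrary: \<sigma>)
  case 0
  then have "\<sigma> = id" by (simp add: permutes_def fun_eq_iff)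
  moreover have "Del 0 q id = {}" by (auto simp: Del_def)
  ultimately show ?case
    using canonical_presentation_eq[OF is_canonical_factorization_small(2)]
    by (simp add: del_def del: id_apply)
next
  case (Suc m)
  from Suc.prems obtain v p where v: "v permutes {1..m}" and p: "1 \<le> p" "p \<le> Suc m"
    and \<sigma>: "\<sigma> = insert_max m p v"
    by (rule insert_max_cases)
  \<comment> \<open>Both \<open>S\<^sub>0\<close> and \<open>S\<^sub>1\<close> have the empty list of factors, so the step from 0 to 1 adds none.\<close>
  show ?case
  proof (cases "m = 0")
    case True
    with Suc.prems have "\<sigma> permutes {1}" by simp
    then have "\<sigma> = id" by simp
    moreover have "Del (Suc 0) q id = {}" using q by (auto simp: Del_def)
    ultimately show ?thesis
      using True canonical_presentation_eq[OF is_canonical_factorization_small(1)]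
      by (simp add: del_def del: id_apply)
  next
    case False
    then show ?thesis
      using Suc.IH[OF v] del_insert_max[OF v p, of q] card_Del_insert_max[OF v p q] \<sigma> by simp
  qed
qed

section \<open>Descents under insertion of the maximum\<close>

text \<open>
  Membership of \<open>Suc i\<close> in \<open>Del m q \<sigma>\<close> is spelled out, as the bounds on \<open>i\<close> already give the
  range condition. This leaves a condition on each pair of adjacent positions.
\<close>

definition descents_in_Del :: "nat \<Rightarrow> nat \<Rightarrow> (nat \<Rightarrow> nat) \<Rightarrow> bool" where
  "descents_in_Del m q \<sigma> \<longleftrightarrow>
     (\<forall>i. q \<le> i \<longrightarrow> i < m \<longrightarrow> \<sigma> (Suc i) < \<sigma> i \<longrightarrow> smaller_left \<sigma> (Suc i) < q)"

text \<open>
  The inclusion from left to right holds by the definition of \<open>Des\<close>; only the other one is a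
  condition, and it concerns genuine descents.
\<close>

lemma Del_eq_Des_iff:
  assumes "0 < q"
  shows "(\<lambda>i. i - 1) ` Del m q \<sigma> = Des m q \<sigma> \<longleftrightarrow> descents_in_Del m q \<sigma>" (is "?L = ?R \<longleftrightarrow> _")
proof -
  have L: "?L = {i. Suc i \<in> Del m q \<sigma>}"
    by (force simp: Del_def image_iff)
  have "i \<in> ?L \<longleftrightarrow> q \<le> i \<and> i < m \<and> smaller_left \<sigma> (Suc i) < q" for i
    unfolding L by (auto simp: Del_iff[OF assms])
  moreover have "i \<in> ?R \<longleftrightarrow> q \<le> i \<and> i < m \<and> (\<sigma> (Suc i) < \<sigma> i \<or> smaller_left \<sigma> (Suc i) < q)" for i
    unfolding Des_def using assms by (auto simp: Del_iff[OF assms])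
  ultimately show ?thesis
    unfolding descents_in_Del_def set_eq_iff by blast
qed

text \<open>
  Every pair of adjacent positions from \<open>q\<close> on moves one step to the right unchanged. The only
  pair of \<open>insert_max m p v\<close> not obtained in this way is the one at \<open>q\<close> and \<open>q + 1\<close>, which
  satisfies the condition because at most \<open>q - 1\<close> of the entries left of position \<open>q + 1\<close> can be
  smaller than the entry there: one of these \<open>q\<close> entries is the maximum.
\<close>

lemma descents_in_Del_insert_max_early:
  assumes v: "v permutes {1..m}" and p: "1 \<le> p" "p \<le> q" and m: "q \<le> m"
  shows "descents_in_Del (Suc m) q (insert_max m p v) \<longleftrightarrow> descents_in_Del m q v"
proof -
  have p': "p \<le> Suc m" and q: "0 < q" using p m by simp_all
  note ins = insert_max_apply[OF v p(1) p']
  note sl = smaller_left_insert_max[OF v p(1) p']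
  let ?u = "insert_max m p v"
  let ?P = "\<lambda>\<sigma> i. \<sigma> (Suc i) < \<sigma> i \<longrightarrow> smaller_left \<sigma> (Suc i) < q"
  have start: "?P ?u q"
    using sl(3)[of q] smaller_left_less[OF q, of v] p m by simp
  have step: "?P ?u (Suc i) \<longleftrightarrow> ?P v i" if "q \<le> i" "i < m" for i
    using ins(3)[of i] ins(3)[of "Suc i"] sl(3)[of "Suc i"] that p by simp
  show ?thesis
  proof
    assume u: "descents_in_Del (Suc m) q ?u"
    have "?P v i" if "q \<le> i" "i < m" for i
      using step[OF that] u that by (simp add: descents_in_Del_def)
    then show "descents_in_Del m q v" by (simp add: descents_in_Del_def)
  next
    assume v': "descents_in_Del m q v"
    have "?P ?u i" if i: "q \<le> i" "i < Suc m" for i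
    proof (cases "i = q")
      case True
      with start show ?thesis by blast
    next
      case False
      with i obtain j where "i = Suc j" "q \<le> j" "j < m" by (cases i) auto
      then show ?thesis using step[of j] v' by (simp add: descents_in_Del_def)
    qed
    then show "descents_in_Del (Suc m) q ?u" by (simp add: descents_in_Del_def)
  qed
qed

text \<open>
  The maximum splits the pair \<open>p - 1, p\<close> into an ascent and, if \<open>p \<le> m\<close>, a descent. The descent
  requires \<open>p \<in> Del m q v\<close>, which in turn implies the condition on the pair that was split.
\<close>

lemma descents_in_Del_insert_max_late:
  assumes v: "v permutes {1..m}" and p: "q < p" "p \<le> Suc m" and q: "0 < q"
  shows "descents_in_Del (Suc m) q (insert_max m p v) \<longleftrightarrow>
    descents_in_Del m q v \<and> p \<in> insert (Suc m) (Del m q v)"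
proof -
  have p1: "1 \<le> p" using p by simp
  note ins = insert_max_apply[OF v p1 p(2)]
  note sl = smaller_left_insert_max[OF v p1 p(2)]
  let ?u = "insert_max m p v"
  let ?P = "\<lambda>\<sigma> i. \<sigma> (Suc i) < \<sigma> i \<longrightarrow> smaller_left \<sigma> (Suc i) < q"
  have before: "?P ?u i \<longleftrightarrow> ?P v i" if "Suc i < p" for i
    using ins(1)[of i] ins(1)[of "Suc i"] sl(1)[of "Suc i"] that by simp
  have at: "?P ?u i" if "Suc i = p" for i
    using ins(1)[of i] ins(2) permutes_le[OF v, of i] that p by simp
  have after: "?P ?u p \<longleftrightarrow> smaller_left v p < q" if "p \<le> m"
    using ins(2) ins(3)[of p] sl(3)[of p] permutes_le[OF v that] that by simp
  have far: "?P ?u (Suc i) \<longleftrightarrow> ?P v i" if "p \<le> i" "i < m" for i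
    using ins(3)[of i] ins(3)[of "Suc i"] sl(3)[of "Suc i"] that by simp
  show ?thesis
  proof
    assume u: "descents_in_Del (Suc m) q ?u"
    then have P: "?P ?u i" if "q \<le> i" "i \<le> m" for i
      using that by (simp add: descents_in_Del_def)
    have pDel: "smaller_left v p < q" if "p \<le> m" using P[of p] after that p by simp
    have "?P v i" if i: "q \<le> i" "i < m" for i
    proof -
      consider "Suc i < p" | "Suc i = p" | "p \<le> i" by linarith
      then show ?thesis
      proof cases
        case 1 then show ?thesis using before P[of i] i by simp
      next
        case 2 then show ?thesis using pDel i by simp
      next
        case 3 then show ?thesis using far P[of "Suc i"] i by simp
      qed
    qed
    then show "descents_in_Del m q v \<and> p \<in> insert (Suc m) (Del m q v)"
      using pDel p by (auto simp: descents_in_Del_def Del_iff[OF q])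
  next
    assume R: "descents_in_Del m q v \<and> p \<in> insert (Suc m) (Del m q v)"
    then have P: "?P v i" if "q \<le> i" "i < m" for i
      using that by (simp add: descents_in_Del_def)
    have "?P ?u i" if i: "q \<le> i" "i < Suc m" for i
    proof -
      consider "Suc i < p" | "Suc i = p" | "p = i" | j where "i = Suc j" "p \<le> j"
        by (metis Suc_lessI linorder_neqE_nat less_imp_Suc_add le_add1)
      then show ?thesis
      proof cases
        case 1 then show ?thesis using before P[of i] i p by simp
      next
        case 2 then show ?thesis using at by blast
      next
        case 3 then show ?thesis using after R i by (auto simp: Del_iff[OF q])
      next
        case 4 then show ?thesis using far[of j] P[of j] i p by simp
      qed
    qed
    then show "descents_in_Del (Suc m) q ?u" by (simp add: descents_in_Del_def)
  qed
qed

section \<open>The Stirling recurrence\<close>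

definition del_perms :: "nat \<Rightarrow> nat \<Rightarrow> nat \<Rightarrow> (nat \<Rightarrow> nat) set" where
  "del_perms m q k = {\<sigma>. \<sigma> permutes {1..m} \<and> descents_in_Del m q \<sigma> \<and> card (Del m q \<sigma>) = k}"

lemma finite_del_perms [simp]: "finite (del_perms m q k)"
  by (rule finite_subset[of _ "{\<sigma>. \<sigma> permutes {1..m}}"]) (auto simp: del_perms_def finite_permutations)

text \<open>
  The insertions that keep the descent condition fall into two classes: any of the \<open>q\<close> early positions raises the size
  of \<open>Del\<close> by one, and the late positions \<open>m + 1\<close> and the \<open>k\<close> elements of \<open>Del\<close> preserve it.
\<close>

lemma card_del_perms_Suc:
  assumes q: "0 < q" and m: "q \<le> m"
  shows "card (del_perms (Suc m) q k) =
    q * (case k of 0 \<Rightarrow> 0 | Suc k' \<Rightarrow> card (del_perms m q k')) + Suc k * card (del_perms m q k)"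
proof -
  let ?f = "\<lambda>(v, p). insert_max m p v"
  let ?X = "{v. v permutes {1..m}} \<times> {1..Suc m}"
  let ?E = "(case k of 0 \<Rightarrow> {} | Suc k' \<Rightarrow> del_perms m q k') \<times> {1..q}"
  let ?F = "SIGMA v:del_perms m q k. insert (Suc m) (Del m q v)"
  have "x \<in> ?E \<union> ?F \<longleftrightarrow> x \<in> ?X \<and> ?f x \<in> del_perms (Suc m) q k" for x
  proof -
    obtain v p where x: "x = (v, p)" by (cases x)
    show ?thesis
    proof (cases "x \<in> ?X")
      case False
      then show ?thesis
        using m by (auto simp: x del_perms_def Del_iff[OF q] split: nat.splits)
    next
      case True
      then have v: "v permutes {1..m}" and p: "1 \<le> p" "p \<le> Suc m" by (auto simp: x)
      note perm = insert_max_permutes[OF v p]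
      show ?thesis
      proof (cases "p \<le> q")
        case True
        then show ?thesis
          using v p m perm card_Del_insert_max[OF v p q] descents_in_Del_insert_max_early[OF v p(1) True m]
          by (auto simp: x del_perms_def Del_iff[OF q] split: nat.splits)
      next
        case False
        then have "q < p" by simp
        then show ?thesis
          using v p m perm card_Del_insert_max[OF v p q]
            descents_in_Del_insert_max_late[OF v \<open>q < p\<close> p(2) q]
          by (auto simp: x del_perms_def split: nat.splits)
      qed
    qed
  qed
  then have EF: "?E \<union> ?F = {x \<in> ?X. ?f x \<in> del_perms (Suc m) q k}" by blast
  have "bij_betw ?f (?E \<union> ?F) (del_perms (Suc m) q k)"
  proof (rule bij_betw_subset[OF bij_betw_insert_max[of m]])
    show "?f ` (?E \<union> ?F) = del_perms (Suc m) q k"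
    proof
      show "del_perms (Suc m) q k \<subseteq> ?f ` (?E \<union> ?F)"
      proof
        fix \<sigma> assume \<sigma>: "\<sigma> \<in> del_perms (Suc m) q k"
        then have "\<sigma> \<in> ?f ` ?X"
          using bij_betw_imp_surj_on[OF bij_betw_insert_max[of m]] by (auto simp: del_perms_def)
        with \<sigma> show "\<sigma> \<in> ?f ` (?E \<union> ?F)" unfolding EF by blast
      qed
    qed (use EF in blast)
  qed (use EF in blast)
  then have "card (del_perms (Suc m) q k) = card (?E \<union> ?F)"
    by (simp add: bij_betw_same_card)
  also have "\<dots> = card ?E + card ?F"
  proof (rule card_Un_disjoint)
    show "?E \<inter> ?F = {}" using m by (auto simp: Del_iff[OF q])
  qed (auto split: nat.splits)
  also have "card ?E = q * (case k of 0 \<Rightarrow> 0 | Suc k' \<Rightarrow> card (del_perms m q k'))"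
    by (simp add: card_cartesian_product split: nat.splits)
  also have "card ?F = (\<Sum>v\<in>del_perms m q k. Suc k)"
  proof -
    have "card (insert (Suc m) (Del m q v)) = Suc k" if "v \<in> del_perms m q k" for v
      using that by (subst card_insert_disjoint) (auto simp: del_perms_def Del_iff[OF q])
    then show ?thesis by (subst card_SigmaI) auto
  qed
  finally show ?thesis by simp
qed

theorem card_del_perms:
  assumes q: "0 < q"
  shows "card (del_perms (q + t) q k) = fact (q - 1) * q ^ Suc k * Stirling (Suc t) (Suc k)"
proof (induction t arbitrary: k)
  case 0
  have "Del q q \<sigma> = {}" for \<sigma> by (auto simp: Del_def)
  then have "del_perms q q k = (if k = 0 then {\<sigma>. \<sigma> permutes {1..q}} else {})"
    by (auto simp: del_perms_def descents_in_Del_def)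
  then have "card (del_perms q q k) = (if k = 0 then fact q else 0)"
    using card_permutations[of "{1..q}" q] by simp
  moreover have "(fact q :: nat) = fact (q - 1) * q"
    using fact_reduce[OF q, where 'a = nat] by simp
  ultimately show ?case by (cases k) simp_all
next
  case (Suc t)
  show ?case
  proof (cases k)
    case 0
    then show ?thesis
      using card_del_perms_Suc[OF q, of "q + t" k] Suc.IH by simp
  next
    case (Suc k')
    then show ?thesis
      using card_del_perms_Suc[OF q, of "q + t" k] Suc.IH by (simp add: algebra_simps)
  qed
qed

theorem proposition2p7:
  fixes n q k :: nat
  assumes "n > 0" and "q > 0" and "k > 0"
  shows "card {\<sigma>. \<sigma> permutes {1..n + q - 1} \<and>
                  (\<lambda>i. i - 1) ` Del (n + q - 1) q \<sigma> = Des (n + q - 1) q \<sigma> \<and>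
                  del (n + q - 1) q \<sigma> = k - 1}
         = fact (q - 1) * q ^ k * Stirling n k"
proof -
  have m: "q + (n - 1) = n + q - 1" using assms by simp
  have "\<sigma> permutes {1..n + q - 1} \<and>
      (\<lambda>i. i - 1) ` Del (n + q - 1) q \<sigma> = Des (n + q - 1) q \<sigma> \<and>
      del (n + q - 1) q \<sigma> = k - 1 \<longleftrightarrow> \<sigma> \<in> del_perms (n + q - 1) q (k - 1)" for \<sigma>
    unfolding del_perms_def mem_Collect_eq Del_eq_Des_iff[OF \<open>q > 0\<close>]
    using del_eq_card_Del[OF _ \<open>q > 0\<close>] by metis
  then show ?thesis
    using card_del_perms[OF \<open>q > 0\<close>, of "n - 1" "k - 1"] assms unfolding m by simp
qed

end
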